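(* $\mathrm{SAT}$ is Karp-reducible (i.e. reducible by a polynomial-time many-one reduction) to $\lnot \mathrm{cOSM}^*$.
   Context: $\mathrm{SAT}$: given a Boolean formula describing a Boolean function $f:\{0,1\}^n\to\{0,1\}$, decide whether there is an assignment $(x_1,\dots,x_n)$ with $f(x_1,\dots,x_n)=1$. For $n\ge1$ and a Boolean function $f:\{0,1\}^n\to\{0,1\}$, the associated $\pi$-LME state is $|\psi_f\rangle=\frac{1}{\sqrt{2^n}}\sum_{\vec s\in\{0,1\}^n}(-1)^{f(\vec s)}|\vec s\rangle\in(\mathbb{C}^2)^{\otimes n}$. Let $|\pm\rangle=\frac{|0\rangle\pm|1\rangle}{\sqrt 2}$, and let $\pm\{|\pm\rangle\}^{\otimes n}$ be the set of vectors $\varepsilon\,|\phi_1\rangle\otimes\cdots\otimes|\phi_n\rangle$ with $\varepsilon\in\{1,-1\}$ and each $|\phi_j\rangle\in\{|+\rangle,|-\rangle\}$. $\lnot\mathrm{cOSM}^*$: given a Boolean formula in the variables $x_1,\dots,x_n$ describing $f$ (with $n$ part of the input), decide whether $|\psi_f\rangle\notin\pm\{|\pm\rangle\}^{\otimes n}$ (answer "yes" iff it does not belong). *)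

theory Defs
  imports Complex_Main "HOL-Computational_Algebra.Polynomial"
begin

section \<open>Polynomial-time computable functions and Karp reductions\<close>

text \<open>
  Deterministic multi-tape Turing machines with one-way infinite tapes over the input letters
  \<open>'a\<close>, a blank, and auxiliary work symbols. The carrier sets \<open>states\<close> and \<open>alphabet\<close> are required
  to be finite in \<open>wf_tm\<close>.
\<close>

datatype 'a tape_symbol = Blank | Letter 'a | Work nat

datatype move = MoveLeft | Stay | MoveRight

record 'a tm =
  num_tapes :: nat
  alphabet :: "'a tape_symbol set"
  states :: "nat set"
  start_state :: nat
  halt_state :: nat
  delta :: "nat \<Rightarrow> 'a tape_symbol list \<Rightarrow> nat \<times> ('a tape_symbol \<times> move) list"

definition wf_tm :: "'a tm \<Rightarrow> bool" where
  "wf_tm M \<longleftrightarrow>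
     num_tapes M \<ge> 1 \<and>
     finite (alphabet M) \<and> Blank \<in> alphabet M \<and> range Letter \<subseteq> alphabet M \<and>
     finite (states M) \<and> start_state M \<in> states M \<and> halt_state M \<in> states M \<and>
     (\<forall>q \<in> states M - {halt_state M}. \<forall>rs.
        length rs = num_tapes M \<and> set rs \<subseteq> alphabet M \<longrightarrow>
        (case delta M q rs of (q', acts) \<Rightarrow>
           q' \<in> states M \<and> length acts = num_tapes M \<and> fst ` set acts \<subseteq> alphabet M))"

text \<open>A tape consists of its contents and the head position.\<close>

type_synonym 'a tape = "(nat \<Rightarrow> 'a tape_symbol) \<times> nat"

type_synonym 'a config = "nat \<times> 'a tape list"

definition word_contents :: "'a list \<Rightarrow> nat \<Rightarrow> 'a tape_symbol" where
  "word_contents w i = (if i < length w then Letter (w ! i) else Blank)"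

text \<open>A left move in the leftmost cell leaves the head where it is (truncated subtraction).\<close>

fun move_head :: "move \<Rightarrow> nat \<Rightarrow> nat" where
  "move_head MoveLeft h = h - 1"
| "move_head Stay h = h"
| "move_head MoveRight h = h + 1"

definition read_tape :: "'a tape \<Rightarrow> 'a tape_symbol" where
  "read_tape tp = fst tp (snd tp)"

definition act_tape :: "'a tape_symbol \<times> move \<Rightarrow> 'a tape \<Rightarrow> 'a tape" where
  "act_tape a tp = ((fst tp)(snd tp := fst a), move_head (snd a) (snd tp))"

definition tm_step :: "'a tm \<Rightarrow> 'a config \<Rightarrow> 'a config" where
  "tm_step M c =
     (if fst c = halt_state M then c
      else case delta M (fst c) (map read_tape (snd c)) of
             (q', acts) \<Rightarrow> (q', map2 act_tape acts (snd c)))"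

text \<open>The input is on the first tape, the output is read off the last tape.\<close>

definition initial_config :: "'a tm \<Rightarrow> 'a list \<Rightarrow> 'a config" where
  "initial_config M w =
     (start_state M, (word_contents w, 0) # replicate (num_tapes M - 1) (word_contents [], 0))"

text \<open>
  Halting configurations are fixed points of \<open>tm_step\<close>, so the configuration after \<open>t\<close> steps is
  halting iff \<open>M\<close> halts within at most \<open>t\<close> steps.
\<close>

definition outputs_within :: "'a tm \<Rightarrow> 'a list \<Rightarrow> 'a list \<Rightarrow> nat \<Rightarrow> bool" where
  "outputs_within M w v t \<longleftrightarrow>
     (let c = (tm_step M ^^ t) (initial_config M w)
      in fst c = halt_state M \<and> fst (last (snd c)) = word_contents v)"

definition polytime_computable :: "('a list \<Rightarrow> 'a list) \<Rightarrow> bool" where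
  "polytime_computable F \<longleftrightarrow>
     (\<exists>(M :: 'a tm) (p :: nat poly). wf_tm M \<and>
        (\<forall>w. outputs_within M w (F w) (poly p (length w))))"

definition karp_reducible :: "'a list set \<Rightarrow> 'a list set \<Rightarrow> bool" where
  "karp_reducible A B \<longleftrightarrow> (\<exists>F. polytime_computable F \<and> (\<forall>w. w \<in> A \<longleftrightarrow> F w \<in> B))"


section \<open>Boolean formulas and their encoding as words\<close>

datatype formula =
    Var nat
  | Neg formula
  | Conj formula formula
  | Disj formula formula

fun vars :: "formula \<Rightarrow> nat set" where
  "vars (Var i) = {i}"
| "vars (Neg a) = vars a"
| "vars (Conj a b) = vars a \<union> vars b"
| "vars (Disj a b) = vars a \<union> vars b"

text \<open>
  Variables are numbered from 1: the variable \<open>Var i\<close> refers to the \<open>i\<close>-th bit of the assignment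
  \<open>s\<close>, which is \<open>s ! (i - 1)\<close>.
\<close>

fun eval :: "formula \<Rightarrow> bool list \<Rightarrow> bool" where
  "eval (Var i) s \<longleftrightarrow> s ! (i - 1)"
| "eval (Neg a) s \<longleftrightarrow> \<not> eval a s"
| "eval (Conj a b) s \<longleftrightarrow> eval a s \<and> eval b s"
| "eval (Disj a b) s \<longleftrightarrow> eval a s \<or> eval b s"

text \<open>
  An instance is a pair of a number \<open>n\<close> and a formula in the variables \<open>1, \<dots>, n\<close> (not all of which
  need to occur); it describes the Boolean function \<open>eval a\<close> on the bit strings of length \<open>n\<close>.
\<close>

definition valid_instance :: "nat \<Rightarrow> formula \<Rightarrow> bool" where
  "valid_instance n a \<longleftrightarrow> n \<ge> 1 \<and> vars a \<subseteq> {1..n}"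

text \<open>
  Numbers are written in binary, most significant bit first and without leading zeros, and formulas
  in Polish notation. Bits occur in a formula only directly after \<open>VarSym\<close>, so that no separator is
  needed at the end of a variable index.
\<close>

datatype symbol = Bit0 | Bit1 | Sep | VarSym | NegSym | ConjSym | DisjSym

fun enc_nat :: "nat \<Rightarrow> symbol list" where
  "enc_nat n = (if n = 0 then [] else enc_nat (n div 2) @ [if even n then Bit0 else Bit1])"

declare enc_nat.simps [simp del]

fun enc_formula :: "formula \<Rightarrow> symbol list" where
  "enc_formula (Var i) = VarSym # enc_nat i"
| "enc_formula (Neg a) = NegSym # enc_formula a"
| "enc_formula (Conj a b) = ConjSym # enc_formula a @ enc_formula b"
| "enc_formula (Disj a b) = DisjSym # enc_formula a @ enc_formula b"

definition enc_instance :: "nat \<Rightarrow> formula \<Rightarrow> symbol list" where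
  "enc_instance n a = enc_nat n @ Sep # enc_formula a"

lemma enc_nat_bits: "set (enc_nat n) \<subseteq> {Bit0, Bit1}"
proof (induction n rule: enc_nat.induct)
  case (1 n) then show ?case by (subst enc_nat.simps) auto
qed

lemma enc_nat_0: "enc_nat 0 = []"
  by (simp add: enc_nat.simps)

lemma enc_nat_pos:
  "n \<noteq> 0 \<Longrightarrow> enc_nat n = enc_nat (n div 2) @ [if even n then Bit0 else Bit1]"
  using enc_nat.simps[of n] by (simp only: if_False)

lemma enc_nat_inject: "enc_nat m = enc_nat n \<Longrightarrow> m = n"
proof (induction m arbitrary: n rule: less_induct)
  case (less m)
  show ?case
  proof (cases "m = 0 \<or> n = 0")
    case True
    then show ?thesis using less.prems enc_nat_pos[of m] enc_nat_pos[of n]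
      by (cases "m = 0"; cases "n = 0") (simp_all add: enc_nat_0)
  next
    case False
    have eq: "enc_nat (m div 2) = enc_nat (n div 2)" "even m = even n"
      using less.prems enc_nat_pos[of m] enc_nat_pos[of n] False
      by (simp_all split: if_splits)
    have "m div 2 = n div 2"
      using False by (intro less.IH eq(1)) simp
    moreover have "m mod 2 = n mod 2"
      using eq(2) by presburger
    ultimately show ?thesis
      by (metis div_mult_mod_eq)
  qed
qed

lemma append_split_unique:
  assumes "xs @ r = ys @ r'" "set xs \<subseteq> S" "set ys \<subseteq> S"
    "r = [] \<or> hd r \<notin> S" "r' = [] \<or> hd r' \<notin> S"
  shows "xs = ys \<and> r = r'"
  using assms
proof (induction xs arbitrary: ys)
  case Nil then show ?case by (cases ys) auto
next
  case (Cons x xs) then show ?case by (cases ys) auto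
qed

lemma hd_enc_formula: "hd (enc_formula a @ r) \<notin> {Bit0, Bit1}"
  by (cases a) simp_all

lemma enc_formula_prefix:
  assumes "enc_formula a @ r = enc_formula b @ r'"
    "r = [] \<or> hd r \<notin> {Bit0, Bit1}" "r' = [] \<or> hd r' \<notin> {Bit0, Bit1}"
  shows "a = b \<and> r = r'"
  using assms
proof (induction a arbitrary: b r r')
  case (Var i)
  from Var(1) obtain j where b: "b = Var j" by (cases b) simp_all
  have eq: "enc_nat i @ r = enc_nat j @ r'"
    using Var(1) unfolding b by simp
  have "enc_nat i = enc_nat j \<and> r = r'"
    by (rule append_split_unique[OF eq enc_nat_bits enc_nat_bits Var(2,3)])
  then show ?case using enc_nat_inject unfolding b by blast
next
  case (Neg a)
  from Neg.prems(1) obtain b1 where b: "b = Neg b1" by (cases b) simp_all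
  have eq: "enc_formula a @ r = enc_formula b1 @ r'"
    using Neg.prems(1) unfolding b by simp
  show ?case using Neg.IH[OF eq Neg.prems(2,3)] unfolding b by blast
next
  case (Conj a1 a2)
  from Conj.prems(1) obtain b1 b2 where b: "b = Conj b1 b2" by (cases b) simp_all
  have eq: "enc_formula a1 @ (enc_formula a2 @ r) = enc_formula b1 @ (enc_formula b2 @ r')"
    using Conj.prems(1) unfolding b by simp
  have "a1 = b1 \<and> enc_formula a2 @ r = enc_formula b2 @ r'"
    by (rule Conj.IH(1)[OF eq disjI2[OF hd_enc_formula] disjI2[OF hd_enc_formula]])
  moreover from this have "a2 = b2 \<and> r = r'"
    by (intro Conj.IH(2)[OF _ Conj.prems(2,3)]) (rule conjunct2)
  ultimately show ?case unfolding b by blast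
next
  case (Disj a1 a2)
  from Disj.prems(1) obtain b1 b2 where b: "b = Disj b1 b2" by (cases b) simp_all
  have eq: "enc_formula a1 @ (enc_formula a2 @ r) = enc_formula b1 @ (enc_formula b2 @ r')"
    using Disj.prems(1) unfolding b by simp
  have "a1 = b1 \<and> enc_formula a2 @ r = enc_formula b2 @ r'"
    by (rule Disj.IH(1)[OF eq disjI2[OF hd_enc_formula] disjI2[OF hd_enc_formula]])
  moreover from this have "a2 = b2 \<and> r = r'"
    by (intro Disj.IH(2)[OF _ Disj.prems(2,3)]) (rule conjunct2)
  ultimately show ?case unfolding b by blast
qed

lemma enc_instance_inject:
  assumes "enc_instance m a = enc_instance n b"
  shows "m = n \<and> a = b"
proof -
  have "enc_nat m = enc_nat n \<and> Sep # enc_formula a = Sep # enc_formula b"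
    using assms unfolding enc_instance_def
    by (rule append_split_unique[OF _ enc_nat_bits enc_nat_bits]) auto
  then show ?thesis using enc_nat_inject enc_formula_prefix[of a "[]" b "[]"] by auto
qed


section \<open>The states associated with Boolean functions\<close>

text \<open>
  A vector of \<open>\<complex>\<^sup>2\<close> is given by its amplitudes with respect to the basis indexed by \<open>bool\<close>
  (with \<open>False\<close> for 0 and \<open>True\<close> for 1). A vector of the \<open>n\<close>-fold tensor power is given by its
  amplitudes on the bit strings of length \<open>n\<close>, and is extended by 0 to all other lists, so that
  equality of such functions is equality of vectors.
\<close>

type_synonym qubit = "bool \<Rightarrow> complex"

type_synonym qubits = "bool list \<Rightarrow> complex"

definition tensor :: "qubit list \<Rightarrow> qubits" where
  "tensor qs t = (if length t = length qs then \<Prod>j<length qs. (qs ! j) (t ! j) else 0)"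

definition ket_bit :: "bool \<Rightarrow> qubit" where
  "ket_bit b = (\<lambda>c. if c = b then 1 else 0)"

definition ket :: "bool list \<Rightarrow> qubits" where
  "ket s = tensor (map ket_bit s)"

definition ket_plus :: qubit where
  "ket_plus = (\<lambda>c. (ket_bit False c + ket_bit True c) / complex_of_real (sqrt 2))"

definition ket_minus :: qubit where
  "ket_minus = (\<lambda>c. (ket_bit False c - ket_bit True c) / complex_of_real (sqrt 2))"

definition lme_state :: "nat \<Rightarrow> (bool list \<Rightarrow> bool) \<Rightarrow> qubits" where
  "lme_state n f = (\<lambda>t.
     1 / complex_of_real (sqrt (2 ^ n)) *
       (\<Sum>s | length s = n. (-1) ^ of_bool (f s) * ket s t))"

definition signed_plus_minus_products :: "nat \<Rightarrow> qubits set" where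
  "signed_plus_minus_products n =
     {(\<lambda>t. e * tensor qs t) | (e :: complex) qs.
        e \<in> {1, -1} \<and> length qs = n \<and> set qs \<subseteq> {ket_plus, ket_minus}}"


section \<open>The decision problems\<close>

text \<open>Words that do not encode a valid instance are no-instances of both problems.\<close>

definition SAT :: "symbol list set" where
  "SAT = {enc_instance n a | n a.
            valid_instance n a \<and> (\<exists>s. length s = n \<and> eval a s)}"

definition not_cOSM_star :: "symbol list set" where
  "not_cOSM_star = {enc_instance n a | n a.
            valid_instance n a \<and> lme_state n (eval a) \<notin> signed_plus_minus_products n}"

end

(* The reduction sends an instance (n, a) to (N, y1 \<or> y2 \<or> \<not> a'), where a' is a with renamed
   variables and y1, y2 are fresh. If a is unsatisfiable this function is constant, so its state is
   - |+...+>. If x satisfies a, then the restriction y1 \<or> y2 violates the relation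
   \<psi>(00x) \<psi>(11x) = \<psi>(01x) \<psi>(10x) that holds for every product vector.

   Doubling every bit of every binary numeral is a strictly increasing renaming whose positive values
   avoid 1 and 2, which are used for y1 and y2. It preserves and reflects leading zeros and the
   condition that variables lie in {1..n}. Hence the reduction is a word homomorphism, it maps
   malformed words to malformed words, and a two-tape machine computes it in one pass. *)
theory Submission
  imports Defs
begin

section \<open>Word homomorphisms are computable in polynomial time\<close>

text \<open>
  The state \<open>j \<le> K\<close> counts the letters already written for the current input letter, and
  \<open>Suc K\<close> is the halting state.
\<close>

definition hom_delta ::
  "('a \<Rightarrow> 'a list) \<Rightarrow> nat \<Rightarrow> nat \<Rightarrow> 'a tape_symbol list \<Rightarrow> nat \<times> ('a tape_symbol \<times> move) list"
where
  "hom_delta h K j rs =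
     (case rs ! 0 of
        Letter x \<Rightarrow>
          (if j < length (h x) then (Suc j, [(rs ! 0, Stay), (Letter (h x ! j), MoveRight)])
           else (0, [(rs ! 0, MoveRight), (rs ! 1, Stay)]))
      | _ \<Rightarrow> (Suc K, [(rs ! 0, Stay), (rs ! 1, Stay)]))"

text \<open>The input head rests on a letter until its whole image is written, so the letter is read
  afresh at every step and the states only have to count.\<close>

definition hom_tm :: "('a \<Rightarrow> 'a list) \<Rightarrow> nat \<Rightarrow> 'a tm" where
  "hom_tm h K =
     \<lparr>num_tapes = 2, alphabet = insert Blank (range Letter), states = {..Suc K},
      start_state = 0, halt_state = Suc K, delta = hom_delta h K\<rparr>"

lemma wf_hom_tm:
  fixes h :: "'a::finite \<Rightarrow> 'a list"
  assumes "\<And>x. length (h x) \<le> K"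
  shows "wf_tm (hom_tm h K)"
proof -
  have "case hom_delta h K q rs of (q', acts) \<Rightarrow>
      q' \<in> {..Suc K} \<and> length acts = 2 \<and> fst ` set acts \<subseteq> insert Blank (range Letter)"
    if len: "length rs = 2" and set: "set rs \<subseteq> insert Blank (range Letter)" for q rs
  proof -
    obtain a b where rs: "rs = [a, b]"
      using len by (auto simp: length_Suc_conv numeral_2_eq_2)
    have "Suc q \<le> Suc K" if "q < length (h x)" for x
      using that assms[of x] by simp
    then show ?thesis
      using set unfolding rs hom_delta_def by (auto split: tape_symbol.splits)
  qed
  then show ?thesis
    by (auto simp: wf_tm_def hom_tm_def)
qed

section \<open>Runs of the machine\<close>

definition hom_config :: "nat \<Rightarrow> 'a list \<Rightarrow> nat \<Rightarrow> 'a list \<Rightarrow> 'a config" where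
  "hom_config j w i v = (j, [(word_contents w, i), (word_contents v, length v)])"

lemma word_contents_append:
  "(word_contents v)(length v := Letter x) = word_contents (v @ [x])"
  by (auto simp: word_contents_def fun_eq_iff nth_append)

lemma hom_step_emit:
  assumes "i < length w" "j < length (h (w ! i))" "j \<le> K"
  shows "tm_step (hom_tm h K) (hom_config j w i v) = hom_config (Suc j) w i (v @ [h (w ! i) ! j])"
  using assms
  by (simp add: tm_step_def hom_tm_def hom_config_def hom_delta_def read_tape_def act_tape_def
      word_contents_append[symmetric])
    \<comment> \<open>Unfolding \<open>word_contents\<close> evaluates the case on the scanned
      symbol and shows, cell by cell, that writing back the symbol read leaves the input tape
      unchanged.\<close>
    (simp add: act_tape_def word_contents_def fun_eq_iff)

lemma hom_step_next:
  assumes "i < length w" "j = length (h (w ! i))" "j \<le> K"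
  shows "tm_step (hom_tm h K) (hom_config j w i v) = hom_config 0 w (Suc i) v"
  using assms
  by (simp add: tm_step_def hom_tm_def hom_config_def hom_delta_def read_tape_def act_tape_def)
    (simp add: act_tape_def word_contents_def fun_eq_iff)

lemma hom_step_halt:
  "tm_step (hom_tm h K) (hom_config 0 w (length w) v) = hom_config (Suc K) w (length w) v"
  by (simp add: tm_step_def hom_tm_def hom_config_def hom_delta_def read_tape_def act_tape_def)
    (simp add: act_tape_def word_contents_def fun_eq_iff)

lemma hom_steps_emit:
  assumes "i < length w" "length (h (w ! i)) \<le> K" "j \<le> length (h (w ! i))"
  shows "(tm_step (hom_tm h K) ^^ j) (hom_config 0 w i v) = hom_config j w i (v @ take j (h (w ! i)))"
  using assms(3)
  by (induction j) (use assms(1,2) in \<open>simp_all add: hom_step_emit take_Suc_conv_app_nth\<close>)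

lemma hom_steps_letter:
  assumes "i < length w" "length (h (w ! i)) \<le> K"
  shows "(tm_step (hom_tm h K) ^^ Suc (length (h (w ! i)))) (hom_config 0 w i v)
    = hom_config 0 w (Suc i) (v @ h (w ! i))"
  using assms by (simp add: hom_steps_emit hom_step_next)

text \<open>The exact time depends on the letters read; \<open>Suc K\<close> bounds the cost of each
  one: at most \<open>K\<close> steps for writing and one for advancing the input head.\<close>

lemma hom_steps_prefix:
  assumes "\<And>x. length (h x) \<le> K" "i \<le> length w"
  shows "\<exists>t \<le> Suc K * i. (tm_step (hom_tm h K) ^^ t) (hom_config 0 w 0 [])
    = hom_config 0 w i (concat (map h (take i w)))"
  using assms(2)
proof (induction i)
  case 0
  show ?case by simp
next
  case (Suc i)
  then obtain t where t: "t \<le> Suc K * i" "(tm_step (hom_tm h K) ^^ t) (hom_config 0 w 0 [])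
      = hom_config 0 w i (concat (map h (take i w)))"
    by auto
  let ?s = "Suc (length (h (w ! i)))"
  have "(tm_step (hom_tm h K) ^^ (?s + t)) (hom_config 0 w 0 [])
      = hom_config 0 w (Suc i) (concat (map h (take (Suc i) w)))"
    using Suc.prems hom_steps_letter[of i w h K] assms(1)
    by (simp only: funpow_add o_apply t(2) take_Suc_conv_app_nth Suc_le_eq) simp
  moreover have "?s + t \<le> Suc K * Suc i"
    using t(1) assms(1)[of "w ! i"] by simp
  ultimately show ?case by blast
qed

lemma tm_steps_halted:
  assumes "fst c = halt_state M"
  shows "(tm_step M ^^ t) c = c"
  using assms by (induction t) (simp_all add: tm_step_def)

lemma polytime_computable_hom:
  fixes h :: "'a::finite \<Rightarrow> 'a list"
  shows "polytime_computable (\<lambda>w. concat (map h w))"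
proof -
  define K where "K = Max (range (length \<circ> h))"
  have K: "length (h x) \<le> K" for x
    unfolding K_def by (rule Max_ge) auto
  \<comment> \<open>The polynomial is 1 + (K + 1) x; the constant 1 pays for the step on the blank
    after the input.\<close>
  have "outputs_within (hom_tm h K) w (concat (map h w)) (poly [:1, Suc K:] (length w))" for w
  proof -
    let ?M = "hom_tm h K"
    let ?c = "hom_config (Suc K) w (length w) (concat (map h w))"
    obtain t where t: "t \<le> Suc K * length w"
      "(tm_step ?M ^^ t) (hom_config 0 w 0 []) = hom_config 0 w (length w) (concat (map h w))"
      using hom_steps_prefix[of h K "length w" w] K by auto
    \<comment> \<open>\<open>outputs_within\<close> looks at the configuration after exactly the
      polynomial number of steps; the \<open>r\<close> surplus steps are spent in the halting
      configuration.\<close>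
    define r where "r = Suc K * length w - t"
    have "poly [:1, Suc K:] (length w) = r + (1 + t)"
      using t(1) by (simp add: r_def algebra_simps)
    moreover have "(tm_step ?M ^^ (1 + t)) (hom_config 0 w 0 []) = ?c"
      using t(2) by (simp add: hom_step_halt)
    moreover have "(tm_step ?M ^^ r) ?c = ?c"
      by (rule tm_steps_halted) (simp add: hom_config_def hom_tm_def)
    moreover have "initial_config ?M w = hom_config 0 w 0 []"
      by (simp add: initial_config_def hom_config_def hom_tm_def numeral_2_eq_2)
    ultimately have
      "(tm_step ?M ^^ poly [:1, Suc K:] (length w)) (initial_config ?M w) = ?c"
      by (simp only: funpow_add o_apply)
    then show ?thesis
      by (simp add: outputs_within_def Let_def hom_config_def hom_tm_def)
  qed
  with wf_hom_tm[of h K] K show ?thesis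
    unfolding polytime_computable_def by blast
qed


section \<open>The reduction and its action on instances\<close>

text \<open>Finiteness bounds the lengths of the images and makes the tape alphabet finite.\<close>

instance symbol :: finite
proof
  have "(UNIV :: symbol set) = {Bit0, Bit1, Sep, VarSym, NegSym, ConjSym, DisjSym}"
    using symbol.exhaust by blast
  then show "finite (UNIV :: symbol set)"
    by (metis finite.emptyI finite.insertI)
qed

text \<open>In Polish notation a fixed context can be written entirely in front of its last
  argument. The image of \<open>Sep\<close> therefore spells out both disjunctions, the variables 1
  and 2 and the negation, and the translated formula completes it.\<close>

fun red_symbol :: "symbol \<Rightarrow> symbol list" where
  "red_symbol Bit0 = [Bit0, Bit0]"
| "red_symbol Bit1 = [Bit1, Bit1]"
| "red_symbol Sep = [Sep, DisjSym, DisjSym, VarSym, Bit1, VarSym, Bit1, Bit0, NegSym]"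
| "red_symbol x = [x]"

abbreviation red_word :: "symbol list \<Rightarrow> symbol list" where
  "red_word w \<equiv> concat (map red_symbol w)"

section \<open>Doubling the binary digits of a number\<close>

fun double_bits :: "nat \<Rightarrow> nat" where
  "double_bits n = (if n = 0 then 0 else 4 * double_bits (n div 2) + 3 * (n mod 2))"

declare double_bits.simps [simp del]

lemma double_bits_0 [simp]: "double_bits 0 = 0"
  by (simp add: double_bits.simps)

text \<open>The binary digits 0 and 1 become the base 4 digits 0 and 3, whose binary forms are 00
  and 11.\<close>

lemma double_bits_rec: "double_bits n = 4 * double_bits (n div 2) + 3 * (n mod 2)"
  by (cases "n = 0") (simp_all add: double_bits.simps[of n])

text \<open>Comparison is lexicographic in the digits: a larger \<open>n div 2\<close> adds at least
  4, while the last digit can lose at most 3.\<close>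

lemma double_bits_less: "m < n \<Longrightarrow> double_bits m < double_bits n"
proof (induction n arbitrary: m rule: less_induct)
  case (less n)
  show ?case
  proof (cases "m div 2 = n div 2")
    case True
    have "m mod 2 < n mod 2"
      using True less.prems by (metis div_mult_mod_eq nat_add_left_cancel_less)
    moreover have "4 * double_bits (m div 2) = 4 * double_bits (n div 2)"
      using True by simp
    ultimately show ?thesis
      using double_bits_rec[of m] double_bits_rec[of n] by linarith
  next
    case False
    then have "m div 2 < n div 2"
      using less.prems by (simp add: div_le_mono le_neq_implies_less)
    moreover have "n div 2 < n"
      using less.prems by simp
    ultimately have "double_bits (m div 2) < double_bits (n div 2)"
      using less.IH by blast
    moreover have "m mod 2 < 2" by simp
    ultimately show ?thesis
      using double_bits_rec[of m] double_bits_rec[of n] by linarith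
  qed
qed

lemma double_bits_le_iff [simp]: "double_bits m \<le> double_bits n \<longleftrightarrow> m \<le> n"
  by (metis double_bits_less linorder_le_less_linear linorder_not_less order_le_less)

lemma double_bits_eq_iff [simp]: "double_bits m = double_bits n \<longleftrightarrow> m = n"
  by (simp add: eq_iff)

lemma double_bits_ge3: "n > 0 \<Longrightarrow> double_bits n \<ge> 3"
  using double_bits_less[of 1 n] double_bits_rec[of 1] by (cases "n = 1") simp_all

lemma double_bits_pos_iff [simp]: "0 < double_bits n \<longleftrightarrow> 0 < n"
  using double_bits_ge3[of n] by (cases "n = 0") auto

section \<open>Numerals and their preimages\<close>

lemma enc_nat_double_bits: "enc_nat (double_bits n) = red_word (enc_nat n)"
proof (induction n rule: less_induct)
  case (less n)
  show ?case
  proof (cases "n = 0")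
    case True
    then show ?thesis by (simp add: enc_nat_0)
  next
    case False
    let ?N = "double_bits n"
    let ?b = "if even n then Bit0 else Bit1"
    \<comment> \<open>This allows \<open>enc_nat\<close> to be unfolded twice, which splits off the
      two copies of the last digit of \<open>n\<close>.\<close>
    have "?N \<ge> 3" using False double_bits_ge3 by simp
    then have "?N \<noteq> 0" "?N div 2 \<noteq> 0" by simp_all
    then have "enc_nat ?N = enc_nat (?N div 2 div 2)
        @ [if even (?N div 2) then Bit0 else Bit1] @ [if even ?N then Bit0 else Bit1]"
      using enc_nat_pos[of ?N] enc_nat_pos[of "?N div 2"] by simp
    moreover
    have half: "(4 * k + 3) div 2 = 2 * k + 1" for k :: nat
      by presburger
    have "?N = 4 * double_bits (n div 2) + (if even n then 0 else 3)"
      using double_bits_rec[of n] by (simp add: even_iff_mod_2_eq_zero)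
    then have "?N div 2 div 2 = double_bits (n div 2)"
      "even (?N div 2) = even n" "even ?N = even n"
      by (simp_all add: half split: if_splits)
    ultimately have "enc_nat ?N = enc_nat (double_bits (n div 2)) @ [?b, ?b]"
      by simp
    with less[of "n div 2"] False show ?thesis
      by (simp add: enc_nat_pos[of n])
  qed
qed

text \<open>This criterion is one that \<open>red_word\<close> reflects on words of bits, since
  doubling the bits does not change the first one.\<close>

lemma range_enc_nat:
  "u \<in> range enc_nat \<longleftrightarrow> set u \<subseteq> {Bit0, Bit1} \<and> (u = [] \<or> hd u = Bit1)"
proof
  assume "u \<in> range enc_nat"
  then obtain n where u: "u = enc_nat n" by auto
  have "n \<noteq> 0 \<Longrightarrow> hd (enc_nat n) = Bit1"
  proof (induction n rule: less_induct)
    case (less n)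
    show ?case
    proof (cases "n = 1")
      case True
      then show ?thesis by (simp add: enc_nat_pos enc_nat_0)
    next
      case False
      with less.prems have "n div 2 \<noteq> 0" "n div 2 < n" by auto
      then have "hd (enc_nat (n div 2)) = Bit1"
        using less.IH[of "n div 2"] by simp
      moreover have "enc_nat (n div 2) \<noteq> []"
        using \<open>n div 2 \<noteq> 0\<close> by (simp add: enc_nat_pos[of "n div 2"])
      ultimately show ?thesis
        using less.prems by (simp add: enc_nat_pos[of n])
    qed
  qed
  then show "set u \<subseteq> {Bit0, Bit1} \<and> (u = [] \<or> hd u = Bit1)"
    using enc_nat_bits[of n] enc_nat_0 unfolding u by (cases "n = 0") auto
next
  assume "set u \<subseteq> {Bit0, Bit1} \<and> (u = [] \<or> hd u = Bit1)"
  then show "u \<in> range enc_nat"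
  proof (induction u rule: rev_induct)
    case Nil
    then show ?case using enc_nat_0 by (metis rangeI)
  next
    case (snoc x u)
    then have "u \<in> range enc_nat" by (cases u) auto
    then obtain n where n: "u = enc_nat n" by auto
    have x: "x = Bit0 \<or> x = Bit1" using snoc.prems by auto
    \<comment> \<open>Appending \<open>Bit0\<close> to the empty word would create a leading
      zero.\<close>
    have pos: "n \<noteq> 0" if "x = Bit0"
      using that snoc.prems n enc_nat_0 by (cases "n = 0") auto
    have "enc_nat (2 * n + of_bool (x = Bit1)) = u @ [x]"
      using x pos by (auto simp: n enc_nat_pos)
    then show ?case by (metis rangeI)
  qed
qed

lemma red_word_eq_enc_nat:
  assumes "red_word u = enc_nat m" "set u \<subseteq> {Bit0, Bit1}"
  obtains n where "u = enc_nat n" "m = double_bits n"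
proof -
  have "red_word u \<in> range enc_nat"
    using assms(1) by simp
  then have "red_word u = [] \<or> hd (red_word u) = Bit1"
    by (simp only: range_enc_nat)
  then have "u = [] \<or> hd u = Bit1"
    using assms(2) by (cases u) auto
  then obtain n where "u = enc_nat n"
    using assms(2) range_enc_nat[of u] by auto
  moreover from this have "m = double_bits n"
    using assms(1) enc_nat_inject by (simp add: enc_nat_double_bits)
  ultimately show thesis by (rule that)
qed

text \<open>Images of bits consist of bits and images of other symbols start with a non-bit, so the
  maximal initial block of bits in \<open>w\<close> is mapped onto that of its image.\<close>

lemma red_word_eq_enc_nat_append:
  assumes "red_word w = enc_nat m @ r" "r = [] \<or> hd r \<notin> {Bit0, Bit1}"
  obtains n v where "w = enc_nat n @ v" "m = double_bits n" "red_word v = r"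
proof -
  let ?S = "{Bit0, Bit1}"
  define u v where "u = takeWhile (\<lambda>x. x \<in> ?S) w" and "v = dropWhile (\<lambda>x. x \<in> ?S) w"
  have w: "w = u @ v" by (simp add: u_def v_def)
  have u: "set u \<subseteq> ?S" unfolding u_def by (auto dest: set_takeWhileD)
  then have ru: "set (red_word u) \<subseteq> ?S" by auto
  have "v = [] \<or> hd v \<notin> ?S"
    unfolding v_def using hd_dropWhile by blast
  then have rv: "red_word v = [] \<or> hd (red_word v) \<notin> ?S"
    by (cases v; cases "hd v") auto
  have "red_word u @ red_word v = enc_nat m @ r"
    using assms(1) unfolding w by simp
  from append_split_unique[OF this ru enc_nat_bits rv assms(2)]
  have eq: "red_word u = enc_nat m" "red_word v = r" by simp_all
  from red_word_eq_enc_nat[OF eq(1) u] obtain n where "u = enc_nat n" "m = double_bits n" .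
  with w eq(2) show thesis by (intro that[of n v]) simp_all
qed

section \<open>Renaming variables and parsing preimages of formulas\<close>

fun rename :: "(nat \<Rightarrow> nat) \<Rightarrow> formula \<Rightarrow> formula" where
  "rename f (Var i) = Var (f i)"
| "rename f (Neg a) = Neg (rename f a)"
| "rename f (Conj a b) = Conj (rename f a) (rename f b)"
| "rename f (Disj a b) = Disj (rename f a) (rename f b)"

lemma vars_rename: "vars (rename f a) = f ` vars a"
  by (induction a) auto

lemma eval_rename:
  assumes "\<And>i. i \<in> vars a \<Longrightarrow> t ! (f i - 1) = s ! (i - 1)"
  shows "eval (rename f a) t \<longleftrightarrow> eval a s"
  using assms by (induction a) auto

lemma enc_formula_rename:
  "enc_formula (rename double_bits a) = red_word (enc_formula a)"
  by (induction a) (simp_all add: enc_nat_double_bits)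

text \<open>Each \<open>red_symbol x\<close> begins with \<open>x\<close> itself.\<close>

lemma red_word_eq_Cons:
  assumes "red_word w = x # r"
  obtains v where "w = x # v" "red_symbol x @ red_word v = x # r"
  using assms by (cases w; cases "hd w") auto

text \<open>The remainder \<open>r\<close> is carried along because the first argument of a binary
  connective is followed by the second; the condition on \<open>r\<close> marks where a variable
  index ends.\<close>

lemma red_word_eq_enc_formula_append:
  assumes "red_word w = enc_formula b @ r" "r = [] \<or> hd r \<notin> {Bit0, Bit1}"
  shows "\<exists>a v. w = enc_formula a @ v \<and> b = rename double_bits a \<and> red_word v = r"
  using assms
proof (induction b arbitrary: w r)
  case (Var i)
  from Var.prems(1) obtain w' where w': "w = VarSym # w'" "red_word w' = enc_nat i @ r"
    by (auto elim!: red_word_eq_Cons)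
  from red_word_eq_enc_nat_append[OF w'(2) Var.prems(2)] obtain n v
    where "w' = enc_nat n @ v" "i = double_bits n" "red_word v = r" .
  then show ?case
    using w'(1) by (intro exI[of _ "Var n"] exI[of _ v]) simp
next
  case (Neg b)
  from Neg.prems(1) obtain w' where w': "w = NegSym # w'" "red_word w' = enc_formula b @ r"
    by (auto elim!: red_word_eq_Cons)
  from Neg.IH[OF w'(2) Neg.prems(2)] obtain a v
    where "w' = enc_formula a @ v" "b = rename double_bits a" "red_word v = r" by blast
  then show ?case
    using w'(1) by (intro exI[of _ "Neg a"] exI[of _ v]) simp
next
  case (Conj b c)
  from Conj.prems(1) obtain w' where w': "w = ConjSym # w'"
    "red_word w' = enc_formula b @ (enc_formula c @ r)"
    by (auto elim!: red_word_eq_Cons)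
  from Conj.IH(1)[OF w'(2) disjI2[OF hd_enc_formula]] obtain a v
    where a: "w' = enc_formula a @ v" "b = rename double_bits a" "red_word v = enc_formula c @ r"
    by blast
  from Conj.IH(2)[OF a(3) Conj.prems(2)] obtain a' v'
    where "v = enc_formula a' @ v'" "c = rename double_bits a'" "red_word v' = r" by blast
  then show ?case
    using w'(1) a by (intro exI[of _ "Conj a a'"] exI[of _ v']) simp
next
  case (Disj b c)
  from Disj.prems(1) obtain w' where w': "w = DisjSym # w'"
    "red_word w' = enc_formula b @ (enc_formula c @ r)"
    by (auto elim!: red_word_eq_Cons)
  from Disj.IH(1)[OF w'(2) disjI2[OF hd_enc_formula]] obtain a v
    where a: "w' = enc_formula a @ v" "b = rename double_bits a" "red_word v = enc_formula c @ r"
    by blast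
  from Disj.IH(2)[OF a(3) Disj.prems(2)] obtain a' v'
    where "v = enc_formula a' @ v'" "c = rename double_bits a'" "red_word v' = r" by blast
  then show ?case
    using w'(1) a by (intro exI[of _ "Disj a a'"] exI[of _ v']) simp
qed

section \<open>The action on whole instances\<close>

definition red_formula :: "formula \<Rightarrow> formula" where
  "red_formula a = Disj (Disj (Var 1) (Var 2)) (Neg (rename double_bits a))"

lemma enc_nat_1: "enc_nat 1 = [Bit1]" and enc_nat_2: "enc_nat 2 = [Bit1, Bit0]"
  by (simp_all add: enc_nat_pos enc_nat_0)

lemma red_word_enc_instance:
  "red_word (enc_instance n a) = enc_instance (double_bits n) (red_formula a)"
  by (simp add: enc_instance_def enc_nat_double_bits red_formula_def enc_formula_rename
      enc_nat_1[simplified] enc_nat_2)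

text \<open>Consequently no malformed word is mapped to an encoded instance.\<close>

lemma red_word_eq_enc_instance:
  assumes "red_word w = enc_instance m b"
  obtains n a where "w = enc_instance n a" "m = double_bits n" "b = red_formula a"
proof -
  have "red_word w = enc_nat m @ Sep # enc_formula b"
    using assms by (simp add: enc_instance_def)
  then obtain n v where n: "w = enc_nat n @ v" "m = double_bits n" "red_word v = Sep # enc_formula b"
    by (rule red_word_eq_enc_nat_append) simp
  from n(3) obtain v' where v': "v = Sep # v'"
    "enc_formula b = [DisjSym, DisjSym, VarSym, Bit1, VarSym, Bit1, Bit0, NegSym] @ red_word v'"
    by (auto elim!: red_word_eq_Cons)
  then obtain b1 b2 where b: "b = Disj b1 b2"
    by (cases b) auto
  have "enc_formula b1 @ enc_formula b2 = enc_formula (Disj (Var 1) (Var 2)) @ NegSym # red_word v'"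
    using v'(2) b by (simp add: enc_nat_1[simplified] enc_nat_2)
  then have b1: "b1 = Disj (Var 1) (Var 2) \<and> enc_formula b2 = NegSym # red_word v'"
    by (rule enc_formula_prefix)
      (use hd_enc_formula[of b2 "[]"] in \<open>simp_all\<close>)
  then obtain c where c: "b2 = Neg c" "red_word v' = enc_formula c @ []"
    by (cases b2) auto
  from red_word_eq_enc_formula_append[OF c(2)] obtain a u
    where a: "v' = enc_formula a @ u" "c = rename double_bits a" "red_word u = []" by blast
  \<comment> \<open>No symbol has an empty image.\<close>
  have "u = []"
    using a(3) by (cases u; cases "hd u") auto
  then show thesis
    using n v'(1) b b1 c(1) a
    by (intro that[of n a]) (simp_all add: enc_instance_def red_formula_def)
qed

lemma valid_instance_red:
  "valid_instance (double_bits n) (red_formula a) \<longleftrightarrow> valid_instance n a"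
proof (cases "n = 0")
  case True
  then show ?thesis by (simp add: valid_instance_def)
next
  case False
  \<comment> \<open>Hence the fresh variables 1 and 2 lie in the admissible range.\<close>
  then have "double_bits n \<ge> 3" using double_bits_ge3 by simp
  then have "valid_instance (double_bits n) (red_formula a)
      \<longleftrightarrow> (\<forall>i \<in> vars a. 1 \<le> double_bits i \<and> double_bits i \<le> double_bits n)"
    by (auto simp: valid_instance_def red_formula_def vars_rename)
  also have "\<dots> \<longleftrightarrow> valid_instance n a"
    using False by (auto simp: valid_instance_def Suc_le_eq)
  finally show ?thesis .
qed


section \<open>Product states\<close>

lemma tensor_Cons: "tensor (q # qs) (b # t) = q b * tensor qs t"
  by (simp add: tensor_def prod.lessThan_Suc_shift del: prod.lessThan_Suc)

lemma ket_eq: "ket s t = of_bool (s = t)"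
proof (cases "length s = length t \<and> s \<noteq> t")
  case True
  then obtain j where "j < length s" "s ! j \<noteq> t ! j"
    by (auto simp: list_eq_iff_nth_eq)
  then have "(\<Prod>j<length s. (map ket_bit s ! j) (t ! j)) = 0"
    by (intro prod_zero) (auto simp: ket_bit_def)
  with True show ?thesis by (simp add: ket_def tensor_def)
next
  case False
  \<comment> \<open>Strings of different lengths fall under this case, through the default value 0
    of \<open>tensor\<close>.\<close>
  then show ?thesis by (auto simp: ket_def tensor_def ket_bit_def)
qed

lemma lme_state_eq:
  "lme_state n f t =
     (if length t = n then (-1) ^ of_bool (f t) / complex_of_real (sqrt (2 ^ n)) else 0)"
proof -
  have "finite {s :: bool list. length s = n}"
    using finite_lists_length_eq[of "UNIV :: bool set" n] by simp
  then show ?thesis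
    by (simp add: lme_state_def ket_eq of_bool_def[of "_ = t"] if_distrib[of "(*) _"] sum.delta
        cong: if_cong)
qed

lemma lme_state_constant:
  assumes "\<And>t. length t = n \<Longrightarrow> f t"
  shows "lme_state n f \<in> signed_plus_minus_products n"
proof -
  have "lme_state n f = (\<lambda>t. -1 * tensor (replicate n ket_plus) t)"
  proof
    fix t :: "bool list"
    have "ket_plus b = 1 / complex_of_real (sqrt 2)" for b
      by (cases b) (simp_all add: ket_plus_def ket_bit_def)
    then show "lme_state n f t = -1 * tensor (replicate n ket_plus) t"
      using assms[of t]
      by (simp add: lme_state_eq tensor_def real_sqrt_power power_one_over)
  qed
  then show ?thesis
    unfolding signed_plus_minus_products_def
    by (intro CollectI exI[of _ "-1"] exI[of _ "replicate n ket_plus"]) auto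
qed

lemma lme_state_disj_not_product:
  assumes f: "\<And>b c. f (b # c # t) \<longleftrightarrow> b \<or> c" and t: "n = length t + 2"
  shows "lme_state n f \<notin> signed_plus_minus_products n"
proof
  let ?\<psi> = "\<lambda>b c. lme_state n f (b # c # t)"
  assume "lme_state n f \<in> signed_plus_minus_products n"
  then obtain e qs where \<psi>: "lme_state n f = (\<lambda>t. e * tensor qs t)" and "length qs = n"
    by (auto simp: signed_plus_minus_products_def)
  then obtain q r qs' where "qs = q # r # qs'"
    using t by (auto simp: length_Suc_conv)
  then have "?\<psi> b c = e * (q b * (r c * tensor qs' t))" for b c
    by (simp add: \<psi> tensor_Cons)
  then have "?\<psi> False False * ?\<psi> True True = ?\<psi> False True * ?\<psi> True False"
    by (simp add: algebra_simps)
  \<comment> \<open>The signs of the four amplitudes make the left product negative and the right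
    one positive, with equal nonzero absolute values.\<close>
  then show False
    by (simp add: lme_state_eq f t)
qed

section \<open>Correctness of the reduction\<close>

lemma red_formula_correct:
  assumes "valid_instance n a"
  shows "lme_state (double_bits n) (eval (red_formula a)) \<notin> signed_plus_minus_products (double_bits n)
    \<longleftrightarrow> (\<exists>s. length s = n \<and> eval a s)"
proof
  assume "\<exists>s. length s = n \<and> eval a s"
  then obtain s where s: "length s = n" "eval a s" by blast
  \<comment> \<open>\<open>t\<close> assigns the variables from 3 on: \<open>double_bits i\<close>
    receives the bit of variable \<open>i\<close>, and the numbers outside the range of the renaming
    get \<open>False\<close>.\<close>
  define t where "t = map (\<lambda>k. \<exists>i \<in> {1..n}. k = double_bits i \<and> s ! (i - 1)) [3..<Suc (double_bits n)]"
  have n: "double_bits n \<ge> 3"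
    using assms double_bits_ge3 by (simp add: valid_instance_def)
  have "eval (rename double_bits a) (b # c # t) \<longleftrightarrow> eval a s" for b c
  proof (rule eval_rename)
    fix i assume "i \<in> vars a"
    then have i: "i \<in> {1..n}" using assms by (auto simp: valid_instance_def)
    then have "3 \<le> double_bits i" "double_bits i \<le> double_bits n"
      using double_bits_ge3 by simp_all
    \<comment> \<open>The offset 3 comes from numbering variables from 1 and from the two bits in
      front of \<open>t\<close>.\<close>
    then have "(b # c # t) ! (double_bits i - 1) = t ! (double_bits i - 3)"
      by (simp add: nth_Cons' numeral_3_eq_3 numeral_2_eq_2)
    also have "\<dots> \<longleftrightarrow> (\<exists>i' \<in> {1..n}. double_bits i = double_bits i' \<and> s ! (i' - 1))"
      using \<open>3 \<le> double_bits i\<close> \<open>double_bits i \<le> double_bits n\<close>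
      by (simp add: t_def less_diff_iff less_Suc_eq_le del: double_bits_eq_iff double_bits_le_iff upt_Suc)
    also have "\<dots> \<longleftrightarrow> s ! (i - 1)"
      using i by auto
    finally show "(b # c # t) ! (double_bits i - 1) \<longleftrightarrow> s ! (i - 1)" .
  qed
  then have "eval (red_formula a) (b # c # t) \<longleftrightarrow> b \<or> c" for b c
    using s(2) by (simp add: red_formula_def)
  moreover have "double_bits n = length t + 2"
    using n by (simp add: t_def)
  ultimately show "lme_state (double_bits n) (eval (red_formula a))
      \<notin> signed_plus_minus_products (double_bits n)"
    by (rule lme_state_disj_not_product)
next
  assume not_product: "lme_state (double_bits n) (eval (red_formula a))
      \<notin> signed_plus_minus_products (double_bits n)"
  \<comment> \<open>A function that is true everywhere would give a product state, so some
    assignment falsifies the disjunction and thereby satisfies the renamed formula.\<close>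
  then obtain t where t: "\<not> eval (red_formula a) t"
    using lme_state_constant[of "double_bits n" "eval (red_formula a)"] by blast
  define s where "s = map (\<lambda>i. t ! (double_bits i - 1)) [1..<Suc n]"
  have "eval (rename double_bits a) t \<longleftrightarrow> eval a s"
  proof (rule eval_rename)
    fix i assume "i \<in> vars a"
    then have "i \<in> {1..n}" using assms by (auto simp: valid_instance_def)
    then have "i - 1 < n" "1 + (i - 1) = i" by auto
    then show "t ! (double_bits i - 1) \<longleftrightarrow> s ! (i - 1)"
      by (simp add: s_def del: upt_Suc)
  qed
  then have "eval a s" using t by (simp add: red_formula_def)
  moreover have "length s = n" by (simp add: s_def)
  ultimately show "\<exists>s. length s = n \<and> eval a s" by blast
qed

lemma red_word_correct: "w \<in> SAT \<longleftrightarrow> red_word w \<in> not_cOSM_star"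
proof
  assume "w \<in> SAT"
  then obtain n a where "w = enc_instance n a" "valid_instance n a"
    "\<exists>s. length s = n \<and> eval a s"
    by (auto simp: SAT_def)
  then show "red_word w \<in> not_cOSM_star"
    unfolding not_cOSM_star_def
    using red_word_enc_instance valid_instance_red red_formula_correct by blast
next
  assume "red_word w \<in> not_cOSM_star"
  then obtain m b where b: "red_word w = enc_instance m b" "valid_instance m b"
    "lme_state m (eval b) \<notin> signed_plus_minus_products m"
    by (auto simp: not_cOSM_star_def)
  from b(1) obtain n a where "w = enc_instance n a" "m = double_bits n" "b = red_formula a"
    by (rule red_word_eq_enc_instance)
  then show "w \<in> SAT"
    unfolding SAT_def
    using b(2,3) valid_instance_red red_formula_correct by blast
qed

theorem theorem2: "karp_reducible SAT not_cOSM_star"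
  unfolding karp_reducible_def
  using polytime_computable_hom[of red_symbol] red_word_correct by blast

end
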